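(* Let $f$ be analytic and univalent in the unit disk $\mathbb{D}$, and let $\phi$ be an analytic function on $f(\mathbb{D})$. Then $$\operatorname{Re}\left\{\frac{d}{dz}\big(\phi(f(z))\big)\right\}=\operatorname{Re}\left\{\phi'(f(z))f'(z)\right\}>0\quad\text{for all } z\in\mathbb{D}$$ if and only if there exist constants $c>0$, $c_1\in\mathbb{R}$, $c_0\in\mathbb{C}$ and a real-valued function $\mu$ on $[0,2\pi]$ that is increasing in the wide sense (non-decreasing) and of total variation equal to $1$, such that $$\phi(w)=-c\left[(1+ic_1)f^{-1}(w)+2\int_0^{2\pi}e^{-i\theta}\log\big(1-f^{-1}(w)e^{i\theta}\big)\,d\mu(\theta)\right]+c_0\quad\text{for all } w\in f(\mathbb{D}).$$
   Context: $\mathbb{D}=\{z\in\mathbb{C}:|z|<1\}$; univalent means injective; $f^{-1}:f(\mathbb{D})\to\mathbb{D}$ is the inverse of $f$. The logarithm is the principal branch (so $\log 1=0$; note $\operatorname{Re}(1-\zeta)>0$ for $|\zeta|<1$), and the integral is a Stieltjes integral with respect to $\mu$. *)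

theory Defs
  imports "HOL-Analysis.Analysis"
begin

text \<open>
  Riemann--Stieltjes integral as the limit of the sums
  \<open>\<Sum> g(t\<^sub>j) (\<mu>(x\<^sub>j) - \<mu>(x\<^sub>j\<^sub>-\<^sub>1))\<close> when the mesh tends to 0.  The gauge in \<open>fine\<close> is the
  constant-radius ball, so it bounds the mesh: a subdivision of mesh below \<open>\<delta>\<close> is fine, and a
  fine one has mesh below \<open>2 * \<delta>\<close>.  No one-sided continuity of \<open>\<mu>\<close> is required, unlike for
  the library's \<open>interval_measure\<close>, and jumps of \<open>\<mu>\<close> at the end points \<open>a\<close> and \<open>b\<close> are counted.
  Degenerate intervals contribute 0.
\<close>

definition has_stieltjes_integral ::
    "(real \<Rightarrow> complex) \<Rightarrow> (real \<Rightarrow> real) \<Rightarrow> real \<Rightarrow> real \<Rightarrow> complex \<Rightarrow> bool" where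
  "has_stieltjes_integral g \<mu> a b I \<longleftrightarrow>
     (\<forall>\<epsilon>>0. \<exists>\<delta>>0. \<forall>p. p tagged_division_of {a..b} \<and> (\<lambda>t. ball t \<delta>) fine p \<longrightarrow>
        norm ((\<Sum>(t, K)\<in>p. (\<mu> (Sup K) - \<mu> (Inf K)) *\<^sub>R g t) - I) < \<epsilon>)"

lemma has_stieltjes_integral_unique:
  assumes "has_stieltjes_integral g \<mu> a b I" "has_stieltjes_integral g \<mu> a b J"
  shows "I = J"
proof (rule ccontr)
  assume "I \<noteq> J"
  define S where "S p = (\<Sum>(t, K)\<in>p. (\<mu> (Sup K) - \<mu> (Inf K)) *\<^sub>R g t)" for p
  define e where "e = norm (I - J) / 2"
  have e: "e > 0" using \<open>I \<noteq> J\<close> by (simp add: e_def)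
  obtain d1 where d1: "d1 > 0"
      "\<forall>p. p tagged_division_of {a..b} \<and> (\<lambda>t. ball t d1) fine p \<longrightarrow> norm (S p - I) < e"
    using assms(1)[unfolded has_stieltjes_integral_def, rule_format, OF e]
    unfolding S_def by blast
  obtain d2 where d2: "d2 > 0"
      "\<forall>p. p tagged_division_of {a..b} \<and> (\<lambda>t. ball t d2) fine p \<longrightarrow> norm (S p - J) < e"
    using assms(2)[unfolded has_stieltjes_integral_def, rule_format, OF e]
    unfolding S_def by blast
  have "gauge (\<lambda>t::real. ball t (min d1 d2))"
    using d1(1) d2(1) by (intro gauge_ball) simp
  then obtain p where p: "p tagged_division_of {a..b}" "(\<lambda>t. ball t (min d1 d2)) fine p"
    by (rule fine_division_exists_real)
  have "(\<lambda>t. ball t d1 \<inter> ball t d2) fine p"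
    using p(2) by (simp add: ball_min_Int)
  then have "norm (S p - I) < e" "norm (S p - J) < e"
    using d1(2) d2(2) p(1) unfolding fine_Int by blast+
  moreover have "norm (I - J) \<le> norm (S p - I) + norm (S p - J)"
    using norm_triangle_ineq4[of "S p - J" "S p - I"] by simp
  ultimately show False by (simp add: e_def)
qed

definition stieltjes_integral ::
    "(real \<Rightarrow> complex) \<Rightarrow> (real \<Rightarrow> real) \<Rightarrow> real \<Rightarrow> real \<Rightarrow> complex" where
  "stieltjes_integral g \<mu> a b = (THE I. has_stieltjes_integral g \<mu> a b I)"

definition total_variation :: "(real \<Rightarrow> real) \<Rightarrow> real \<Rightarrow> real \<Rightarrow> ereal" where
  "total_variation \<mu> a b =
     (SUP d \<in> {d. d division_of {a..b}}. ereal (\<Sum>K\<in>d. \<bar>\<mu> (Sup K) - \<mu> (Inf K)\<bar>))"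

end

theory Submission
  imports Defs "HOL-Complex_Analysis.Complex_Analysis"
begin

text \<open>
  Put \<open>g z = \<phi> (f z)\<close>. Since \<open>f\<close> is injective, the formula for \<open>\<phi>\<close> on the image of the disc
  is a formula for \<open>g\<close> on the disc, and the condition on \<open>\<phi>\<close> says that \<open>deriv g\<close> has positive real
  part. Such functions are described by Herglotz: up to an imaginary constant they are positive
  multiples of averages of the kernels \<open>(1 + z u) / (1 - z u)\<close> over \<open>u = exp (\<i> * \<theta>)\<close>
  (\<open>herglotz_representation\<close>). The function \<open>- z - 2 Ln (1 - z u) / u\<close> is the primitive of this
  kernel that vanishes at 0, so integrating the Herglotz formula in \<open>z\<close> gives the stated formula
  with \<open>c = Re (deriv g 0)\<close> and \<open>c\<^sub>1 = - Im (deriv g 0) / c\<close>. Conversely, differentiating the stated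
  formula gives a positive multiple of an average of kernels of positive real part, up to an
  imaginary constant (\<open>Re_cauchy_transform_gt\<close>).

  The passage between derivative and primitive goes through moments. For a nondecreasing integrator
  \<open>\<mu>\<close>, both the average of \<open>1 / (1 - z u)\<close> and that of the logarithmic kernel \<open>Ln (1 - z u) / u\<close> are
  power series in \<open>z\<close> whose coefficients are the moments of \<open>\<mu>\<close> up to explicit factors, so
  termwise differentiation relates them (\<open>has_field_derivative_log_transform\<close>).

  The Stieltjes integral is controlled by \<open>has_stieltjes_integral_quantile\<close>, which rewrites it
  as an ordinary integral via the generalized inverse of \<open>\<mu>\<close>. The existence half of the Herglotz
  theorem rests on \<open>helly_cluster_point\<close>, a compactness principle for monotone functions under
  pointwise convergence.
\<close>

section \<open>Riemann--Stieltjes integrals against a monotone integrator\<close>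

definition stieltjes_sum ::
    "(real \<Rightarrow> complex) \<Rightarrow> (real \<Rightarrow> real) \<Rightarrow> (real \<times> real set) set \<Rightarrow> complex" where
  "stieltjes_sum g \<mu> p = (\<Sum>(t, K)\<in>p. (\<mu> (Sup K) - \<mu> (Inf K)) *\<^sub>R g t)"

lemma tagged_division_of_real_intervalD:
  fixes a b :: real
  assumes "p tagged_division_of {a..b}" "(t, K) \<in> p"
  shows "a \<le> Inf K" "Inf K \<le> t" "t \<le> Sup K" "Sup K \<le> b" "K = {Inf K..Sup K}"
proof -
  from tagged_division_ofD(4)[OF assms] obtain u v where K: "K = {u..v}"
    by (auto simp: cbox_interval)
  have "t \<in> K" "K \<subseteq> {a..b}"
    using tagged_division_ofD(2,3)[OF assms] by auto
  with K have "u \<le> t" "t \<le> v" "a \<le> u" "v \<le> b"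
    by auto
  with K show "a \<le> Inf K" "Inf K \<le> t" "t \<le> Sup K" "Sup K \<le> b" "K = {Inf K..Sup K}"
    by auto
qed

text \<open>
  If the increments of \<open>\<Phi>\<close> approximate each term of the sum with an error proportional to the
  increment of \<open>\<mu>\<close>, both telescope and the errors add up to a multiple of the total increment.
  So \<open>\<Phi>\<close> plays the role of an indefinite integral; below it is produced once from the
  generalized inverse of \<open>\<mu>\<close> and once from a density of \<open>\<mu>\<close>.
\<close>

lemma stieltjes_sum_estimate:
  fixes \<Phi> :: "real \<Rightarrow> complex"
  assumes "a \<le> b" and p: "p tagged_division_of {a..b}" "(\<lambda>t. ball t \<delta>) fine p"
    and est: "\<And>u v t. \<lbrakk>a \<le> u; u \<le> t; t \<le> v; v \<le> b; {u..v} \<subseteq> ball t \<delta>\<rbrakk> \<Longrightarrow>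
                norm ((\<mu> v - \<mu> u) *\<^sub>R g t - (\<Phi> v - \<Phi> u)) \<le> \<epsilon> * (\<mu> v - \<mu> u)"
  shows "norm (stieltjes_sum g \<mu> p - (\<Phi> b - \<Phi> a)) \<le> \<epsilon> * (\<mu> b - \<mu> a)"
proof -
  have "stieltjes_sum g \<mu> p - (\<Phi> b - \<Phi> a) =
      (\<Sum>(t, K)\<in>p. (\<mu> (Sup K) - \<mu> (Inf K)) *\<^sub>R g t - (\<Phi> (Sup K) - \<Phi> (Inf K)))"
    using additive_tagged_division_1[OF assms(1) p(1), of \<Phi>]
    by (simp add: stieltjes_sum_def sum_subtractf case_prod_beta)
  also have "norm \<dots> \<le> (\<Sum>(t, K)\<in>p. \<epsilon> * (\<mu> (Sup K) - \<mu> (Inf K)))"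
  proof (rule sum_norm_le, clarify)
    fix t K assume tK: "(t, K) \<in> p"
    note iv = tagged_division_of_real_intervalD[OF p(1) tK]
    have "K \<subseteq> ball t \<delta>"
      using p(2) tK by (auto simp: fine_def)
    then show "norm ((\<mu> (Sup K) - \<mu> (Inf K)) *\<^sub>R g t - (\<Phi> (Sup K) - \<Phi> (Inf K)))
        \<le> \<epsilon> * (\<mu> (Sup K) - \<mu> (Inf K))"
      by (intro est iv(1-4)) (simp add: iv(5)[symmetric])
  qed
  also have "\<dots> = \<epsilon> * (\<mu> b - \<mu> a)"
    using additive_tagged_division_1[OF assms(1) p(1), of \<mu>]
    by (simp add: sum_distrib_left[symmetric] case_prod_beta)
  finally show ?thesis .
qed

lemma has_stieltjes_integralI:
  fixes \<Phi> :: "real \<Rightarrow> complex"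
  assumes "a \<le> b" "\<mu> a \<le> \<mu> b"
    and est: "\<And>\<epsilon>. \<epsilon> > 0 \<Longrightarrow> \<exists>\<delta>>0. \<forall>u v t. a \<le> u \<and> u \<le> t \<and> t \<le> v \<and> v \<le> b \<and> {u..v} \<subseteq> ball t \<delta> \<longrightarrow>
                norm ((\<mu> v - \<mu> u) *\<^sub>R g t - (\<Phi> v - \<Phi> u)) \<le> \<epsilon> * (\<mu> v - \<mu> u)"
  shows "has_stieltjes_integral g \<mu> a b (\<Phi> b - \<Phi> a)"
  unfolding has_stieltjes_integral_def stieltjes_sum_def[symmetric]
proof (intro allI impI)
  fix \<epsilon> :: real assume \<epsilon>: "\<epsilon> > 0"
  \<comment> \<open>The added 1 keeps the quotient meaningful when \<open>\<mu>\<close> is constant.\<close>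
  define \<epsilon>' where "\<epsilon>' = \<epsilon> / (\<mu> b - \<mu> a + 1)"
  have "\<epsilon>' > 0" using \<epsilon> assms(2) by (simp add: \<epsilon>'_def)
  from est[OF this] obtain \<delta> where \<delta>: "\<delta> > 0"
    "\<And>u v t. \<lbrakk>a \<le> u; u \<le> t; t \<le> v; v \<le> b; {u..v} \<subseteq> ball t \<delta>\<rbrakk> \<Longrightarrow>
       norm ((\<mu> v - \<mu> u) *\<^sub>R g t - (\<Phi> v - \<Phi> u)) \<le> \<epsilon>' * (\<mu> v - \<mu> u)"
    by blast
  have "\<epsilon>' * (\<mu> b - \<mu> a) < \<epsilon>' * (\<mu> b - \<mu> a + 1)"
    using \<open>\<epsilon>' > 0\<close> by simp
  also have "\<dots> = \<epsilon>" using assms(2) by (simp add: \<epsilon>'_def)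
  finally have less: "\<epsilon>' * (\<mu> b - \<mu> a) < \<epsilon>" .
  have "norm (stieltjes_sum g \<mu> p - (\<Phi> b - \<Phi> a)) < \<epsilon>"
    if "p tagged_division_of {a..b}" "(\<lambda>t. ball t \<delta>) fine p" for p
    by (rule le_less_trans[OF _ less], rule stieltjes_sum_estimate[OF assms(1) that], rule \<delta>(2))
  with \<delta>(1) show "\<exists>\<delta>>0. \<forall>p. p tagged_division_of {a..b} \<and> (\<lambda>t. ball t \<delta>) fine p \<longrightarrow>
           norm (stieltjes_sum g \<mu> p - (\<Phi> b - \<Phi> a)) < \<epsilon>"
    by blast
qed

lemma stieltjes_integral_eqI:
  "has_stieltjes_integral g \<mu> a b I \<Longrightarrow> stieltjes_integral g \<mu> a b = I"
  unfolding stieltjes_integral_def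
  by (rule the_equality) (auto intro: has_stieltjes_integral_unique)

text \<open>
  The generalized inverse of \<open>\<mu>\<close>. Inserting \<open>a\<close> makes the supremum meaningful for
  every argument and keeps the values in the interval \<open>{a..b}\<close>.
\<close>

definition quantile :: "(real \<Rightarrow> real) \<Rightarrow> real \<Rightarrow> real \<Rightarrow> real \<Rightarrow> real" where
  "quantile \<mu> a b y = Sup (insert a {x \<in> {a..b}. \<mu> x \<le> y})"

lemma quantile_bdd: "bdd_above (insert a {x \<in> {a..b::real}. \<mu> x \<le> y})"
  by (rule bdd_above_mono[of "{a..max a b}"]) auto

lemma quantile_upper: "\<lbrakk>x \<in> {a..b}; \<mu> x \<le> y\<rbrakk> \<Longrightarrow> x \<le> quantile \<mu> a b y"
  unfolding quantile_def by (rule cSup_upper[OF _ quantile_bdd]) auto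

lemma quantile_least:
  assumes "a \<le> z" "\<And>x. \<lbrakk>x \<in> {a..b}; \<mu> x \<le> y\<rbrakk> \<Longrightarrow> x \<le> z"
  shows "quantile \<mu> a b y \<le> z"
  unfolding quantile_def by (rule cSup_least) (use assms in auto)

lemma quantile_in_interval:
  assumes "a \<le> b" shows "quantile \<mu> a b y \<in> {a..b}"
proof -
  have "a \<le> quantile \<mu> a b y"
    unfolding quantile_def by (rule cSup_upper[OF _ quantile_bdd]) auto
  moreover have "quantile \<mu> a b y \<le> b"
    by (rule quantile_least) (use assms in auto)
  ultimately show ?thesis by simp
qed

lemma mono_quantile: "mono (quantile \<mu> a b)"
  unfolding quantile_def by (intro monoI cSup_subset_mono quantile_bdd) auto

lemma quantile_between:
  assumes "mono_on {a..b} \<mu>" "a \<le> u" "u \<le> v" "v \<le> b" "\<mu> u \<le> y" "y < \<mu> v"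
  shows "quantile \<mu> a b y \<in> {u..v}"
proof -
  have "u \<le> quantile \<mu> a b y"
    using assms by (intro quantile_upper) auto
  moreover have "x \<le> v" if "x \<in> {a..b}" "\<mu> x \<le> y" for x
  proof (rule ccontr)
    assume "\<not> x \<le> v"
    then have "\<mu> v \<le> \<mu> x"
      using assms that by (intro mono_onD[OF assms(1)]) auto
    with that assms show False by simp
  qed
  then have "quantile \<mu> a b y \<le> v"
    using assms by (intro quantile_least) auto
  ultimately show ?thesis by simp
qed

lemma bounded_on_interval:
  fixes g :: "real \<Rightarrow> complex"
  assumes "continuous_on UNIV g"
  obtains B where "\<And>t. t \<in> {a..b} \<Longrightarrow> norm (g t) \<le> B"
proof -
  have "bounded (g ` {a..b})"
    by (intro compact_imp_bounded compact_continuous_image continuous_on_subset[OF assms]) auto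
  then show ?thesis
    using that by (meson bounded_iff imageI)
qed

lemma integrable_comp_quantile:
  fixes g :: "real \<Rightarrow> complex"
  assumes "a \<le> b" "continuous_on UNIV g"
  shows "(\<lambda>y. g (quantile \<mu> a b y)) integrable_on {c..d}"
proof -
  obtain B where B: "\<And>t. t \<in> {a..b} \<Longrightarrow> norm (g t) \<le> B"
    using bounded_on_interval[OF assms(2)] by blast
  have "(\<lambda>y. g (quantile \<mu> a b y)) \<in> borel_measurable borel"
    using borel_measurable_mono[OF mono_quantile] borel_measurable_continuous_onI[OF assms(2)]
    by measurable
  then have "(\<lambda>y. g (quantile \<mu> a b y)) \<in> borel_measurable (lebesgue_on {c..d})"
    by (intro measurable_restrict_space1) (simp add: measurable_completion)
  then show ?thesis
    by (rule measurable_bounded_by_integrable_imp_integrable[where g = "\<lambda>_. B"])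
       (auto intro!: B quantile_in_interval assms(1) simp: integrable_const_ivl)
qed

lemma uniform_modulus:
  fixes g :: "real \<Rightarrow> complex"
  assumes "continuous_on UNIV g" "\<epsilon> > 0"
  obtains \<delta> where "\<delta> > 0" "\<And>s t. \<lbrakk>s \<in> {a..b}; t \<in> {a..b}; \<bar>s - t\<bar> < \<delta>\<rbrakk> \<Longrightarrow> norm (g s - g t) \<le> \<epsilon>"
proof -
  have "uniformly_continuous_on {a..b} g"
    by (intro compact_uniformly_continuous continuous_on_subset[OF assms(1)]) auto
  then obtain \<delta> where "\<delta> > 0" "\<And>s t. \<lbrakk>s \<in> {a..b}; t \<in> {a..b}; dist t s < \<delta>\<rbrakk> \<Longrightarrow> dist (g t) (g s) < \<epsilon>"
    using assms(2) unfolding uniformly_continuous_on_def by meson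
  then show ?thesis
    by (intro that[of \<delta>]) (auto simp: dist_norm norm_minus_commute abs_minus_commute less_imp_le)
qed

text \<open>
  While \<open>y\<close> runs from \<open>\<mu> u\<close> up to, but excluding, \<open>\<mu> v\<close>, the quantile stays in \<open>{u..v}\<close>, where
  \<open>g\<close> differs from \<open>g t\<close> by at most \<open>\<epsilon>\<close>.
\<close>

lemma quantile_increment_estimate:
  fixes g :: "real \<Rightarrow> complex"
  assumes ab: "a \<le> b" and mono: "mono_on {a..b} \<mu>" and g: "continuous_on UNIV g" and "\<epsilon> \<ge> 0"
    and mod: "\<And>s t. \<lbrakk>s \<in> {a..b}; t \<in> {a..b}; \<bar>s - t\<bar> < \<delta>\<rbrakk> \<Longrightarrow> norm (g s - g t) \<le> \<epsilon>"
    and uv: "a \<le> u" "u \<le> t" "t \<le> v" "v \<le> b" "{u..v} \<subseteq> ball t \<delta>"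
  defines "\<Phi> \<equiv> \<lambda>x. integral {\<mu> a..\<mu> x} (\<lambda>y. g (quantile \<mu> a b y))"
  shows "norm ((\<mu> v - \<mu> u) *\<^sub>R g t - (\<Phi> v - \<Phi> u)) \<le> \<epsilon> * (\<mu> v - \<mu> u)"
proof -
  let ?G = "\<lambda>y. g (quantile \<mu> a b y)"
  have le: "\<mu> a \<le> \<mu> u" "\<mu> u \<le> \<mu> v"
    using uv ab by (auto intro!: mono_onD[OF mono])
  have "\<Phi> v - \<Phi> u = integral {\<mu> u..\<mu> v} ?G"
    using Henstock_Kurzweil_Integration.integral_combine[OF le integrable_comp_quantile[OF ab g]]
    by (simp add: \<Phi>_def algebra_simps)
  then have "(?G has_integral (\<Phi> v - \<Phi> u)) {\<mu> u..\<mu> v}"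
    using integrable_integral[OF integrable_comp_quantile[OF ab g]] by simp
  moreover have "((\<lambda>y. g t) has_integral (\<mu> v - \<mu> u) *\<^sub>R g t) {\<mu> u..\<mu> v}"
    using has_integral_const_real[of "g t" "\<mu> u" "\<mu> v"] le by simp
  ultimately have int: "((\<lambda>y. g t - ?G y) has_integral ((\<mu> v - \<mu> u) *\<^sub>R g t - (\<Phi> v - \<Phi> u)))
      (cbox (\<mu> u) (\<mu> v))"
    using has_integral_diff by (simp add: cbox_interval)
  \<comment> \<open>At the right end point the quantile may jump past \<open>v\<close>; one point does not matter.\<close>
  have "norm ((\<mu> v - \<mu> u) *\<^sub>R g t - (\<Phi> v - \<Phi> u)) \<le> \<epsilon> * measure lborel (cbox (\<mu> u) (\<mu> v))"
  proof (rule has_integral_bound_spike_finite[OF \<open>\<epsilon> \<ge> 0\<close> _ int, of "{\<mu> v}"])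
    fix y assume "y \<in> cbox (\<mu> u) (\<mu> v) - {\<mu> v}"
    then have q: "quantile \<mu> a b y \<in> {u..v}"
      using uv by (intro quantile_between[OF mono]) auto
    with uv(5) have "quantile \<mu> a b y \<in> ball t \<delta>" by blast
    then have "\<bar>t - quantile \<mu> a b y\<bar> < \<delta>"
      by (simp add: dist_real_def)
    then show "norm (g t - ?G y) \<le> \<epsilon>"
      using q uv by (intro mod) auto
  qed auto
  then show ?thesis using le by simp
qed

text \<open>
  Substituting the generalized inverse turns the Stieltjes integral into an ordinary integral
  over the interval from \<open>\<mu> a\<close> to \<open>\<mu> b\<close>, whatever the jumps of \<open>\<mu>\<close>. This gives existence, and
  linearity, positivity and dominated convergence are then inherited from ordinary integrals.
  Continuity of \<open>g\<close> on the whole line makes the composition Borel measurable at once.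
\<close>

theorem has_stieltjes_integral_quantile:
  fixes g :: "real \<Rightarrow> complex"
  assumes ab: "a \<le> b" and mono: "mono_on {a..b} \<mu>" and g: "continuous_on UNIV g"
  shows "has_stieltjes_integral g \<mu> a b (integral {\<mu> a..\<mu> b} (\<lambda>y. g (quantile \<mu> a b y)))"
proof -
  let ?\<Phi> = "\<lambda>x. integral {\<mu> a..\<mu> x} (\<lambda>y. g (quantile \<mu> a b y))"
  have "has_stieltjes_integral g \<mu> a b (?\<Phi> b - ?\<Phi> a)"
  proof (rule has_stieltjes_integralI[OF ab])
    show "\<mu> a \<le> \<mu> b" using ab by (auto intro!: mono_onD[OF mono])
    fix \<epsilon> :: real assume "\<epsilon> > 0"
    obtain \<delta> where "\<delta> > 0" "\<And>s t. \<lbrakk>s \<in> {a..b}; t \<in> {a..b}; \<bar>s - t\<bar> < \<delta>\<rbrakk> \<Longrightarrow> norm (g s - g t) \<le> \<epsilon>"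
      using uniform_modulus[OF g \<open>\<epsilon> > 0\<close>] by blast
    with \<open>\<epsilon> > 0\<close> show "\<exists>\<delta>>0. \<forall>u v t. a \<le> u \<and> u \<le> t \<and> t \<le> v \<and> v \<le> b \<and> {u..v} \<subseteq> ball t \<delta> \<longrightarrow>
        norm ((\<mu> v - \<mu> u) *\<^sub>R g t - (?\<Phi> v - ?\<Phi> u)) \<le> \<epsilon> * (\<mu> v - \<mu> u)"
      by (intro exI[of _ \<delta>] conjI allI impI quantile_increment_estimate[OF ab mono g]) auto
  qed
  then show ?thesis by simp
qed

corollary stieltjes_integral_quantile:
  fixes g :: "real \<Rightarrow> complex"
  assumes "a \<le> b" "mono_on {a..b} \<mu>" "continuous_on UNIV g"
  shows "stieltjes_integral g \<mu> a b = integral {\<mu> a..\<mu> b} (\<lambda>y. g (quantile \<mu> a b y))"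
  by (rule stieltjes_integral_eqI[OF has_stieltjes_integral_quantile[OF assms]])

text \<open>
  The subdivision depends on the modulus of continuity of \<open>g\<close> alone, so one subdivision serves
  all integrators of bounded total increment. This uniformity drives the compactness argument.
\<close>

lemma stieltjes_sum_uniform_error:
  fixes g :: "real \<Rightarrow> complex"
  assumes ab: "a \<le> b" and mono: "mono_on {a..b} \<mu>" and g: "continuous_on UNIV g" and "\<epsilon> \<ge> 0"
    and mod: "\<And>s t. \<lbrakk>s \<in> {a..b}; t \<in> {a..b}; \<bar>s - t\<bar> < \<delta>\<rbrakk> \<Longrightarrow> norm (g s - g t) \<le> \<epsilon>"
    and p: "p tagged_division_of {a..b}" "(\<lambda>t. ball t \<delta>) fine p"
  shows "norm (stieltjes_sum g \<mu> p - stieltjes_integral g \<mu> a b) \<le> \<epsilon> * (\<mu> b - \<mu> a)"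
proof -
  let ?\<Phi> = "\<lambda>x. integral {\<mu> a..\<mu> x} (\<lambda>y. g (quantile \<mu> a b y))"
  have "norm (stieltjes_sum g \<mu> p - (?\<Phi> b - ?\<Phi> a)) \<le> \<epsilon> * (\<mu> b - \<mu> a)"
    by (rule stieltjes_sum_estimate[OF ab p],
        rule quantile_increment_estimate[OF ab mono g \<open>\<epsilon> \<ge> 0\<close> mod])
  then show ?thesis
    by (simp add: stieltjes_integral_quantile[OF ab mono g])
qed

lemma stieltjes_integral_const:
  assumes "a \<le> b" "mono_on {a..b} \<mu>"
  shows "stieltjes_integral (\<lambda>_. k) \<mu> a b = (\<mu> b - \<mu> a) *\<^sub>R k"
proof -
  have "\<mu> a \<le> \<mu> b" using assms by (auto intro!: mono_onD[OF assms(2)])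
  then show ?thesis
    by (simp add: stieltjes_integral_quantile[OF assms])
qed

lemma stieltjes_integral_cmult:
  assumes "a \<le> b" "mono_on {a..b} \<mu>" "continuous_on UNIV g"
  shows "stieltjes_integral (\<lambda>t. k * g t) \<mu> a b = k * stieltjes_integral g \<mu> a b"
  using assms by (simp add: stieltjes_integral_quantile continuous_intros)

lemma stieltjes_integral_Re_ge:
  assumes ab: "a \<le> b" and mono: "mono_on {a..b} \<mu>" and g: "continuous_on UNIV g"
    and ge: "\<And>t. t \<in> {a..b} \<Longrightarrow> m \<le> Re (g t)"
  shows "m * (\<mu> b - \<mu> a) \<le> Re (stieltjes_integral g \<mu> a b)"
proof -
  have le: "\<mu> a \<le> \<mu> b" using ab by (auto intro!: mono_onD[OF mono])
  have int: "((\<lambda>y. Re (g (quantile \<mu> a b y))) has_integral Re (stieltjes_integral g \<mu> a b)) {\<mu> a..\<mu> b}"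
    unfolding stieltjes_integral_quantile[OF ab mono g]
    by (intro has_integral_Re integrable_integral integrable_comp_quantile[OF ab g])
  have "((\<lambda>y. m) has_integral m * (\<mu> b - \<mu> a)) {\<mu> a..\<mu> b}"
    using has_integral_const_real[of m "\<mu> a" "\<mu> b"] le by (simp add: mult.commute)
  from has_integral_le[OF this int] show ?thesis
    using ge quantile_in_interval[OF ab] by blast
qed

lemma integral_sums_dominated:
  fixes G :: "nat \<Rightarrow> real \<Rightarrow> complex"
  assumes int: "\<And>n. G n integrable_on {c..d}"
    and bound: "\<And>n y. y \<in> {c..d} \<Longrightarrow> norm (G n y) \<le> M n" and M: "summable M"
    and sums: "\<And>y. y \<in> {c..d} \<Longrightarrow> (\<lambda>n. G n y) sums s y"
  shows "(\<lambda>n. integral {c..d} (G n)) sums integral {c..d} s"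
proof (cases "{c..d} = {}")
  case False
  then obtain y0 where y0: "y0 \<in> {c..d}" by blast
  have Mnn: "M n \<ge> 0" for n
    using order_trans[OF norm_ge_zero bound[OF y0]] .
  have "(\<lambda>N. integral {c..d} (\<lambda>y. \<Sum>n<N. G n y)) \<longlonglongrightarrow> integral {c..d} s"
  proof (rule dominated_convergence(2)[where h = "\<lambda>_. suminf M"])
    fix N y assume "y \<in> {c..d}"
    then have "norm (\<Sum>n<N. G n y) \<le> (\<Sum>n<N. M n)"
      by (intro sum_norm_le bound)
    also have "\<dots> \<le> suminf M"
      by (intro sum_le_suminf M) (auto simp: Mnn)
    finally show "norm (\<Sum>n<N. G n y) \<le> suminf M" .
  qed (use int sums in \<open>auto intro!: integrable_sum simp: sums_def integrable_const_ivl\<close>)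
  then show ?thesis
    using int by (simp add: sums_def integral_sum)
qed simp

lemma stieltjes_integral_sums:
  fixes g :: "nat \<Rightarrow> real \<Rightarrow> complex"
  assumes ab: "a \<le> b" and mono: "mono_on {a..b} \<mu>"
    and g: "\<And>n. continuous_on UNIV (g n)" and s: "continuous_on UNIV s"
    and bound: "\<And>n t. norm (g n t) \<le> M n" and M: "summable M"
    and sums: "\<And>t. (\<lambda>n. g n t) sums s t"
  shows "(\<lambda>n. stieltjes_integral (g n) \<mu> a b) sums stieltjes_integral s \<mu> a b"
  unfolding stieltjes_integral_quantile[OF ab mono g] stieltjes_integral_quantile[OF ab mono s]
  by (rule integral_sums_dominated[OF integrable_comp_quantile[OF ab g] bound M sums])

lemma stieltjes_integral_density:
  fixes g :: "real \<Rightarrow> complex"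
  assumes ab: "a \<le> b" and g: "continuous_on UNIV g" and h: "continuous_on UNIV h"
    and h0: "\<And>x. h x \<ge> (0::real)"
    and \<mu>: "\<And>x. x \<in> {a..b} \<Longrightarrow> \<mu> x = integral {a..x} h"
  shows "stieltjes_integral g \<mu> a b = integral {a..b} (\<lambda>t. h t *\<^sub>R g t)"
proof -
  have hint: "h integrable_on {u..v}" for u v
    by (intro integrable_continuous_real continuous_on_subset[OF h]) auto
  have gint: "(\<lambda>s. h s *\<^sub>R g s) integrable_on {u..v}" for u v
    by (intro integrable_continuous_real continuous_intros continuous_on_subset[OF h]
        continuous_on_subset[OF g]) auto
  have \<mu>int: "(h has_integral (\<mu> v - \<mu> u)) {u..v}" if "a \<le> u" "u \<le> v" "v \<le> b" for u v
    using Henstock_Kurzweil_Integration.integral_combine[of a u v h] hint that \<mu>[of u] \<mu>[of v]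
    by (simp add: has_integral_iff)
  let ?\<Phi> = "\<lambda>x. integral {a..x} (\<lambda>t. h t *\<^sub>R g t)"
  have \<Phi>int: "((\<lambda>t. h t *\<^sub>R g t) has_integral (?\<Phi> v - ?\<Phi> u)) {u..v}" if "a \<le> u" "u \<le> v" for u v
    using Henstock_Kurzweil_Integration.integral_combine[of a u v "\<lambda>t. h t *\<^sub>R g t"] gint that
    by (simp add: has_integral_iff algebra_simps)
  have "has_stieltjes_integral g \<mu> a b (?\<Phi> b - ?\<Phi> a)"
  proof (rule has_stieltjes_integralI[OF ab])
    have "0 \<le> \<mu> b - \<mu> a"
      using \<mu>int[of a b] ab h0 has_integral_nonneg by blast
    then show "\<mu> a \<le> \<mu> b" by simp
    fix \<epsilon> :: real assume "\<epsilon> > 0"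
    obtain \<delta> where \<delta>: "\<delta> > 0" "\<And>s t. \<lbrakk>s \<in> {a..b}; t \<in> {a..b}; \<bar>s - t\<bar> < \<delta>\<rbrakk> \<Longrightarrow> norm (g s - g t) \<le> \<epsilon>"
      using uniform_modulus[OF g \<open>\<epsilon> > 0\<close>] by blast
    have "norm ((\<mu> v - \<mu> u) *\<^sub>R g t - (?\<Phi> v - ?\<Phi> u)) \<le> \<epsilon> * (\<mu> v - \<mu> u)"
      if uv: "a \<le> u" "u \<le> t" "t \<le> v" "v \<le> b" "{u..v} \<subseteq> ball t \<delta>" for u v t
    proof -
      have "((\<lambda>s. h s *\<^sub>R g t - h s *\<^sub>R g s) has_integral ((\<mu> v - \<mu> u) *\<^sub>R g t - (?\<Phi> v - ?\<Phi> u))) {u..v}"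
        using uv by (intro has_integral_diff has_integral_scaleR_left \<mu>int \<Phi>int) auto
      then have "norm ((\<mu> v - \<mu> u) *\<^sub>R g t - (?\<Phi> v - ?\<Phi> u)) =
          norm (integral {u..v} (\<lambda>s. h s *\<^sub>R g t - h s *\<^sub>R g s))"
        by (simp add: integral_unique)
      also have "\<dots> \<le> integral {u..v} (\<lambda>s. \<epsilon> * h s)"
      proof (rule integral_norm_bound_integral)
        fix s assume s: "s \<in> {u..v}"
        then have "s \<in> ball t \<delta>" using uv(5) by blast
        then have "norm (g t - g s) \<le> \<epsilon>"
          using s uv by (intro \<delta>(2)) (auto simp: dist_real_def)
        then have "h s * norm (g t - g s) \<le> h s * \<epsilon>"
          by (rule mult_left_mono) (rule h0)
        then show "norm (h s *\<^sub>R g t - h s *\<^sub>R g s) \<le> \<epsilon> * h s"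
          using h0[of s] by (simp add: scaleR_diff_right[symmetric] mult.commute)
      qed (intro integrable_continuous_real continuous_intros continuous_on_subset[OF h]
            continuous_on_subset[OF g]; simp)+
      also have "\<dots> = \<epsilon> * (\<mu> v - \<mu> u)"
        using \<mu>int[of u v] uv by (simp add: integral_unique)
      finally show ?thesis .
    qed
    with \<delta>(1) show "\<exists>\<delta>>0. \<forall>u v t. a \<le> u \<and> u \<le> t \<and> t \<le> v \<and> v \<le> b \<and> {u..v} \<subseteq> ball t \<delta> \<longrightarrow>
        norm ((\<mu> v - \<mu> u) *\<^sub>R g t - (?\<Phi> v - ?\<Phi> u)) \<le> \<epsilon> * (\<mu> v - \<mu> u)"
      by blast
  qed
  then show ?thesis
    by (simp add: stieltjes_integral_eqI)
qed

text \<open>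
  For a monotone function the sum over every division telescopes to the same value.
\<close>

lemma total_variation_mono_on:
  assumes ab: "a \<le> b" and mono: "mono_on {a..b} \<mu>"
  shows "total_variation \<mu> a b = ereal (\<mu> b - \<mu> a)"
proof -
  have "(\<Sum>K\<in>d. \<bar>\<mu> (Sup K) - \<mu> (Inf K)\<bar>) = \<mu> b - \<mu> a" if d: "d division_of {a..b}" for d
  proof -
    have Kiv: "a \<le> Inf K \<and> Inf K \<le> Sup K \<and> Sup K \<le> b \<and> K = {Inf K..Sup K}" if "K \<in> d" for K
    proof -
      from division_ofD(4)[OF d that] obtain u v where "K = {u..v}"
        by (auto simp: cbox_interval)
      moreover from this have "u \<le> v" "a \<le> u" "v \<le> b"
        using division_ofD(2,3)[OF d that] by auto
      ultimately show ?thesis by simp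
    qed
    \<comment> \<open>Tagging each interval with its left end point makes the telescoping lemma applicable.\<close>
    define p where "p = (\<lambda>K. (Inf K, K)) ` d"
    have "Inf K \<in> K" if "K \<in> d" for K
      using Kiv[OF that] by (metis atLeastAtMost_iff order_refl)
    then have p: "p tagged_division_of {a..b}"
    proof (intro tagged_division_ofI)
      show "finite p" using division_ofD(1)[OF d] by (simp add: p_def)
      show "\<Union> {K. \<exists>x. (x, K) \<in> p} = {a..b}"
        using division_ofD(6)[OF d] by (simp add: p_def image_iff)
      show "\<exists>u v. K = cbox u v" if "(x, K) \<in> p" for x K
        using division_ofD(4)[OF d] that by (auto simp: p_def)
      show "interior K1 \<inter> interior K2 = {}"
        if "(x1, K1) \<in> p" "(x2, K2) \<in> p" "(x1, K1) \<noteq> (x2, K2)" for x1 K1 x2 K2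
        using division_ofD(5)[OF d] that by (auto simp: p_def)
      show "x \<in> K" if "(x, K) \<in> p" for x K
        using \<open>\<And>K. K \<in> d \<Longrightarrow> Inf K \<in> K\<close> that by (auto simp: p_def)
      show "K \<subseteq> {a..b}" if "(x, K) \<in> p" for x K
        using division_ofD(2)[OF d] that by (auto simp: p_def)
    qed
    have inj: "inj_on (\<lambda>K. (Inf K, K)) d" by (auto simp: inj_on_def)
    have "(\<Sum>K\<in>d. \<bar>\<mu> (Sup K) - \<mu> (Inf K)\<bar>) = (\<Sum>K\<in>d. \<mu> (Sup K) - \<mu> (Inf K))"
    proof (intro sum.cong refl abs_of_nonneg)
      fix K assume "K \<in> d"
      from Kiv[OF this] have "\<mu> (Inf K) \<le> \<mu> (Sup K)"
        by (intro mono_onD[OF mono]) (auto simp only: atLeastAtMost_iff intro: order_trans)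
      then show "0 \<le> \<mu> (Sup K) - \<mu> (Inf K)" by simp
    qed
    also have "\<dots> = (\<Sum>(t, K)\<in>p. \<mu> (Sup K) - \<mu> (Inf K))"
      by (simp add: p_def sum.reindex[OF inj])
    also have "\<dots> = \<mu> b - \<mu> a"
      by (rule additive_tagged_division_1[OF ab p])
    finally show ?thesis .
  qed
  moreover have "{d. d division_of {a..b}} \<noteq> {}"
    using elementary_interval[of a b] by (auto simp: cbox_interval)
  ultimately show ?thesis
    unfolding total_variation_def by (intro SUP_eq_const) auto
qed

section \<open>Selection of a limiting integrator\<close>

text \<open>
  By Tychonoff's theorem the functions with values in \<open>{0..1}\<close> form a compact space under
  pointwise convergence, so the sequence \<open>M\<close> has a cluster point there. On monotone functions with
  the prescribed end values, integration of a fixed continuous \<open>g\<close> is continuous for this topology,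
  because it is a uniform limit of Stieltjes sums and each such sum involves finitely many
  function values. Hence a convergent sequence of integrals must converge to the integral
  against the cluster point.
\<close>

theorem helly_cluster_point:
  fixes M :: "nat \<Rightarrow> real \<Rightarrow> real"
  assumes ab: "a \<le> b" and mono: "\<And>n. mono_on {a..b} (M n)"
    and M_ends: "\<And>n. M n a = 0" "\<And>n. M n b = 1" and range: "\<And>n x. M n x \<in> {0..1}"
  obtains \<mu> where "mono_on {a..b} \<mu>" "\<mu> a = 0" "\<mu> b = 1"
    "\<And>g l. continuous_on UNIV g \<Longrightarrow> (\<lambda>n. stieltjes_integral g (M n) a b) \<longlonglongrightarrow> l \<Longrightarrow>
       stieltjes_integral g \<mu> a b = l"
proof -
  define F where "F = filtermap M sequentially"
  have "F \<noteq> bot" by (simp add: F_def filtermap_bot_iff)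
  have "compactin (product_topology (\<lambda>_. euclidean) UNIV) (PiE UNIV (\<lambda>_::real. {0..1::real}))"
    by (subst compactin_PiE) auto
  then have "compact (PiE UNIV (\<lambda>_::real. {0..1::real}))"
    by (simp add: euclidean_product_topology)
  moreover have "eventually (\<lambda>\<nu>. \<nu> \<in> PiE UNIV (\<lambda>_. {0..1})) F"
    using range by (simp add: F_def eventually_filtermap PiE_UNIV_domain)
  ultimately obtain \<mu> where "inf (nhds \<mu>) F \<noteq> bot"
    using \<open>F \<noteq> bot\<close> unfolding compact_filter by blast
  \<comment> \<open>A filter finer than \<open>F\<close> that converges to \<open>\<mu>\<close>: limits along \<open>F\<close> and limits at \<open>\<mu>\<close>
    both become limits along \<open>H\<close>, where limits are unique.\<close>
  define H where "H = inf (nhds \<mu>) F"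
  have H: "H \<noteq> bot" "H \<le> nhds \<mu>" "H \<le> F"
    using \<open>inf (nhds \<mu>) F \<noteq> bot\<close> by (simp_all add: H_def)
  have pointwise: "((\<lambda>\<nu>. \<nu> x) \<longlongrightarrow> \<mu> x) H" for x
  proof -
    have "open ((\<lambda>\<nu>::real \<Rightarrow> real. \<nu> x) -` S)" if "open S" for S
      using that by (intro open_vimage continuous_on_product_coordinates)
    then have "((\<lambda>\<nu>. \<nu> x) \<longlongrightarrow> \<mu> x) (nhds \<mu>)"
      unfolding tendsto_def eventually_nhds by (metis vimage_eq)
    then show ?thesis by (rule tendsto_mono[OF H(2)])
  qed
  have ev: "eventually (\<lambda>\<nu>. mono_on {a..b} \<nu> \<and> \<nu> a = 0 \<and> \<nu> b = 1) H"
    using mono M_ends by (intro filter_leD[OF H(3)]) (simp add: F_def eventually_filtermap)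
  have \<mu>_a: "\<mu> a = 0"
  proof (rule tendsto_unique[OF H(1) pointwise])
    show "((\<lambda>\<nu>. \<nu> a) \<longlongrightarrow> 0) H"
      by (rule tendsto_eventually, rule eventually_mono[OF ev]) simp
  qed
  have \<mu>_b: "\<mu> b = 1"
  proof (rule tendsto_unique[OF H(1) pointwise])
    show "((\<lambda>\<nu>. \<nu> b) \<longlongrightarrow> 1) H"
      by (rule tendsto_eventually, rule eventually_mono[OF ev]) simp
  qed
  have \<mu>_mono: "mono_on {a..b} \<mu>"
  proof (rule mono_onI)
    fix x y assume xy: "x \<in> {a..b}" "y \<in> {a..b}" "x \<le> y"
    show "\<mu> x \<le> \<mu> y"
      by (rule tendsto_le[OF H(1) pointwise pointwise], rule eventually_mono[OF ev])
         (use xy mono_onD in blast)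
  qed
  have lim: "((\<lambda>\<nu>. stieltjes_integral g \<nu> a b) \<longlongrightarrow> stieltjes_integral g \<mu> a b) H"
    if g: "continuous_on UNIV g" for g
  proof (rule tendstoI)
    fix \<epsilon> :: real assume "\<epsilon> > 0"
    then have \<epsilon>: "\<epsilon> / 3 > 0" by simp
    obtain \<delta> where \<delta>: "\<delta> > 0"
      "\<And>s t. \<lbrakk>s \<in> {a..b}; t \<in> {a..b}; \<bar>s - t\<bar> < \<delta>\<rbrakk> \<Longrightarrow> norm (g s - g t) \<le> \<epsilon> / 3"
      using uniform_modulus[OF g \<epsilon>] by blast
    obtain p where p: "p tagged_division_of {a..b}" "(\<lambda>t. ball t \<delta>) fine p"
      using fine_division_exists_real[OF gauge_ball[OF \<delta>(1)]] by blast
    have err: "norm (stieltjes_sum g \<nu> p - stieltjes_integral g \<nu> a b) \<le> \<epsilon> / 3"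
      if "mono_on {a..b} \<nu>" "\<nu> a = 0" "\<nu> b = 1" for \<nu>
      using stieltjes_sum_uniform_error[OF ab that(1) g _ \<delta>(2) p] \<epsilon> that by simp
    have "((\<lambda>\<nu>. stieltjes_sum g \<nu> p) \<longlongrightarrow> stieltjes_sum g \<mu> p) H"
      unfolding stieltjes_sum_def case_prod_beta by (intro tendsto_intros pointwise)
    from tendstoD[OF this \<epsilon>]
    have "eventually (\<lambda>\<nu>. dist (stieltjes_sum g \<nu> p) (stieltjes_sum g \<mu> p) < \<epsilon> / 3) H" .
    with ev show "eventually (\<lambda>\<nu>. dist (stieltjes_integral g \<nu> a b) (stieltjes_integral g \<mu> a b) < \<epsilon>) H"
    proof eventually_elim
      case (elim \<nu>)
      have "norm (stieltjes_integral g \<nu> a b - stieltjes_integral g \<mu> a b) \<le>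
          norm (stieltjes_sum g \<nu> p - stieltjes_integral g \<nu> a b)
          + norm (stieltjes_sum g \<nu> p - stieltjes_sum g \<mu> p)
          + norm (stieltjes_sum g \<mu> p - stieltjes_integral g \<mu> a b)"
        by norm
      with err[of \<nu>] err[OF \<mu>_mono \<mu>_a \<mu>_b] elim show ?case
        by (simp add: dist_norm)
    qed
  qed
  show ?thesis
  proof (rule that[OF \<mu>_mono \<mu>_a \<mu>_b])
    fix g l assume g: "continuous_on UNIV g"
      and l: "(\<lambda>n. stieltjes_integral g (M n) a b) \<longlonglongrightarrow> l"
    have "((\<lambda>\<nu>. stieltjes_integral g \<nu> a b) \<longlongrightarrow> l) F"
      using l by (simp add: F_def filterlim_filtermap)
    then have "((\<lambda>\<nu>. stieltjes_integral g \<nu> a b) \<longlongrightarrow> l) H"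
      by (rule tendsto_mono[OF H(3)])
    then show "stieltjes_integral g \<mu> a b = l"
      by (rule tendsto_unique[OF H(1) lim[OF g]])
  qed
qed

section \<open>Trigonometric moments\<close>

abbreviation (input) unit_exp :: "real \<Rightarrow> complex" where
  "unit_exp \<theta> \<equiv> exp (\<i> * of_real \<theta>)"

definition moment :: "(real \<Rightarrow> real) \<Rightarrow> nat \<Rightarrow> complex" where
  "moment \<mu> n = stieltjes_integral (\<lambda>\<theta>. unit_exp \<theta> ^ n) \<mu> 0 (2*pi)"

definition cauchy_transform :: "(real \<Rightarrow> real) \<Rightarrow> complex \<Rightarrow> complex" where
  "cauchy_transform \<mu> z = stieltjes_integral (\<lambda>\<theta>. 1 / (1 - z * unit_exp \<theta>)) \<mu> 0 (2*pi)"

definition log_transform :: "(real \<Rightarrow> real) \<Rightarrow> complex \<Rightarrow> complex" where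
  "log_transform \<mu> z = stieltjes_integral
     (\<lambda>\<theta>. exp (- \<i> * of_real \<theta>) * Ln (1 - z * unit_exp \<theta>)) \<mu> 0 (2*pi)"

lemma norm_mult_unit_exp [simp]: "norm (z * unit_exp \<theta>) = norm z"
  by (simp add: norm_mult)

lemma one_minus_mult_unit_exp:
  assumes "norm z < 1"
  shows "1 - z * unit_exp \<theta> \<notin> \<real>\<^sub>\<le>\<^sub>0" "1 - z * unit_exp \<theta> \<noteq> 0"
proof -
  have "Re (z * unit_exp \<theta>) < 1"
    using complex_Re_le_cmod[of "z * unit_exp \<theta>"] assms by simp
  then have "Re (1 - z * unit_exp \<theta>) > 0" by simp
  then show "1 - z * unit_exp \<theta> \<notin> \<real>\<^sub>\<le>\<^sub>0" "1 - z * unit_exp \<theta> \<noteq> 0"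
    by (metis complex_nonpos_Reals_iff not_le, metis less_irrefl zero_complex.sel(1))
qed

lemma continuous_cauchy_kernel:
  "norm z < 1 \<Longrightarrow> continuous_on UNIV (\<lambda>\<theta>. 1 / (1 - z * unit_exp \<theta>))"
  by (intro continuous_intros) (use one_minus_mult_unit_exp(2) in blast)

lemma continuous_log_kernel:
  "norm z < 1 \<Longrightarrow> continuous_on UNIV (\<lambda>\<theta>. exp (- \<i> * of_real \<theta>) * Ln (1 - z * unit_exp \<theta>))"
  by (intro continuous_intros) (use one_minus_mult_unit_exp(1) in blast)

text \<open>
  Integrating the geometric series term by term, so the Cauchy transform generates the moments.
\<close>

lemma cauchy_transform_sums:
  assumes mono: "mono_on {0..2*pi} \<mu>" and z: "norm z < 1"
  shows "(\<lambda>n. moment \<mu> n * z ^ n) sums cauchy_transform \<mu> z"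
proof -
  have "(\<lambda>n. stieltjes_integral (\<lambda>\<theta>. z ^ n * unit_exp \<theta> ^ n) \<mu> 0 (2*pi)) sums cauchy_transform \<mu> z"
    unfolding cauchy_transform_def
  proof (rule stieltjes_integral_sums[OF _ mono, where M = "\<lambda>n. norm z ^ n"])
    show "(\<lambda>n. z ^ n * unit_exp \<theta> ^ n) sums (1 / (1 - z * unit_exp \<theta>))" for \<theta>
      using geometric_sums[of "z * unit_exp \<theta>"] z by (simp add: power_mult_distrib)
  qed (use z in \<open>auto intro!: continuous_intros continuous_cauchy_kernel summable_geometric
        simp: norm_mult norm_power\<close>)
  then show ?thesis
    using mono by (simp add: stieltjes_integral_cmult continuous_intros moment_def mult.commute)
qed

text \<open>
  Integrating the Taylor series of the logarithm term by term; the factor \<open>exp (- \<i> * \<theta>)\<close> lowers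
  each frequency by one, so that the coefficient of \<open>z ^ Suc n\<close> involves the moment of order \<open>n\<close>.
\<close>

lemma log_transform_sums:
  assumes mono: "mono_on {0..2*pi} \<mu>" and z: "norm z < 1"
  shows "(\<lambda>n. (- moment \<mu> n / of_nat (Suc n)) * z ^ Suc n) sums log_transform \<mu> z"
proof -
  have "(\<lambda>n. stieltjes_integral (\<lambda>\<theta>. (- (z ^ Suc n) / of_nat (Suc n)) * unit_exp \<theta> ^ n) \<mu> 0 (2*pi))
      sums log_transform \<mu> z"
    unfolding log_transform_def
  proof (rule stieltjes_integral_sums[OF _ mono, where M = "\<lambda>n. norm z ^ n"])
    fix n \<theta>
    have "norm ((- (z ^ Suc n) / of_nat (Suc n)) * unit_exp \<theta> ^ n) =
        norm z * norm z ^ n / real (Suc n)"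
      by (simp add: norm_mult norm_divide norm_power del: of_nat_Suc)
    also have "\<dots> \<le> 1 * norm z ^ n / 1"
      using z by (intro frac_le mult_right_mono) auto
    finally show "norm ((- (z ^ Suc n) / of_nat (Suc n)) * unit_exp \<theta> ^ n) \<le> norm z ^ n" by simp
  next
    fix \<theta>
    let ?w = "z * unit_exp \<theta>"
    have "(\<lambda>n. - (?w ^ n) / of_nat n) sums Ln (1 - ?w)"
      using Ln_series'[of "- ?w"] z by simp
    then have "(\<lambda>n. - (?w ^ Suc n) / of_nat (Suc n)) sums Ln (1 - ?w)"
      by (subst sums_Suc_iff) simp
    then have "(\<lambda>n. exp (- \<i> * of_real \<theta>) * (- (?w ^ Suc n) / of_nat (Suc n))) sums
        (exp (- \<i> * of_real \<theta>) * Ln (1 - ?w))"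
      by (rule sums_mult)
    moreover have term_eq: "exp (- \<i> * of_real \<theta>) * (- (?w ^ Suc n) / of_nat (Suc n)) =
        (- (z ^ Suc n) / of_nat (Suc n)) * unit_exp \<theta> ^ n" for n
    proof -
      have "exp (- \<i> * of_real \<theta>) * unit_exp \<theta> = 1"
        by (simp add: exp_minus)
      then have "exp (- \<i> * of_real \<theta>) * ?w ^ Suc n = z ^ Suc n * unit_exp \<theta> ^ n"
        by (simp add: power_mult_distrib algebra_simps)
      then show ?thesis by (simp del: power_Suc of_nat_Suc)
    qed
    ultimately show "(\<lambda>n. (- (z ^ Suc n) / of_nat (Suc n)) * unit_exp \<theta> ^ n) sums
        (exp (- \<i> * of_real \<theta>) * Ln (1 - ?w))"
      by (simp only: term_eq)
    show "continuous_on UNIV (\<lambda>\<theta>. (- (z ^ Suc n) / of_nat (Suc n)) * unit_exp \<theta> ^ n)" for n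
      by (intro continuous_on_mult_left continuous_intros)
    show "continuous_on UNIV (\<lambda>\<theta>. exp (- \<i> * of_real \<theta>) * Ln (1 - z * unit_exp \<theta>))"
      by (rule continuous_log_kernel[OF z])
    show "summable (\<lambda>n. norm z ^ n)"
      using z by (simp add: summable_geometric)
  qed simp
  moreover have "stieltjes_integral (\<lambda>\<theta>. (- (z ^ Suc n) / of_nat (Suc n)) * unit_exp \<theta> ^ n) \<mu> 0 (2*pi) =
      (- moment \<mu> n / of_nat (Suc n)) * z ^ Suc n" for n
    using stieltjes_integral_cmult[OF _ mono, of "\<lambda>\<theta>. unit_exp \<theta> ^ n" "- (z ^ Suc n) / of_nat (Suc n)"]
    by (simp add: continuous_intros moment_def del: power_Suc of_nat_Suc)
  ultimately show ?thesis by (simp only:)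
qed

lemma has_field_derivative_log_transform:
  assumes mono: "mono_on {0..2*pi} \<mu>" and z: "norm z < 1"
  shows "(log_transform \<mu> has_field_derivative - cauchy_transform \<mu> z) (at z)"
proof -
  \<comment> \<open>The Taylor coefficients of the logarithmic transform, which vanishes at 0.\<close>
  define c where "c n = (if n = 0 then 0 else - moment \<mu> (n - 1) / of_nat n)" for n
  have sums: "(\<lambda>n. c n * w ^ n) sums log_transform \<mu> w" if "norm w < 1" for w
  proof -
    have "(\<lambda>n. c (Suc n) * w ^ Suc n) sums log_transform \<mu> w"
      using log_transform_sums[OF mono that] by (simp add: c_def)
    then show ?thesis by (subst (asm) sums_Suc_iff) (simp add: c_def)
  qed
  have diffs: "diffs c = (\<lambda>n. - moment \<mu> n)"
    by (rule ext) (simp add: diffs_def c_def del: of_nat_Suc)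
  \<comment> \<open>Any point of the disc further out than \<open>z\<close> witnesses convergence beyond \<open>z\<close>.\<close>
  define K :: complex where "K = of_real ((1 + norm z) / 2)"
  have K: "norm z < norm K" "norm K < 1"
    using z by (simp_all add: K_def del: of_real_add of_real_divide)
  have "((\<lambda>w. \<Sum>n. c n * w ^ n) has_field_derivative (\<Sum>n. diffs c n * z ^ n)) (at z)"
    using sums[OF K(2)] K(1) by (intro termdiffs_strong[of c K]) (auto simp: sums_iff)
  moreover have "(\<Sum>n. diffs c n * z ^ n) = - cauchy_transform \<mu> z"
    using sums_minus[OF cauchy_transform_sums[OF mono z]] by (simp add: diffs sums_iff)
  ultimately have "((\<lambda>w. \<Sum>n. c n * w ^ n) has_field_derivative - cauchy_transform \<mu> z) (at z)"
    by simp
  then show ?thesis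
    by (rule has_field_derivative_transform_within_open[of _ _ _ "ball 0 1"])
       (use z sums in \<open>auto simp: sums_iff\<close>)
qed

text \<open>
  The fractional linear map \<open>w \<mapsto> 1 / (1 - w)\<close> sends the closed disc of radius \<open>\<rho> < 1\<close> to a disc whose
  leftmost point is the image of \<open>- \<rho>\<close>.
\<close>

lemma Re_cauchy_kernel_ge:
  fixes w :: complex
  assumes "norm w < 1"
  shows "1 / (1 + norm w) \<le> Re (1 / (1 - w))"
proof -
  define x \<rho> where "x = Re w" and "\<rho> = norm w"
  have \<rho>: "\<rho>\<^sup>2 = x\<^sup>2 + (Im w)\<^sup>2" "\<rho> \<ge> 0" "\<rho> < 1" "- \<rho> \<le> x" "x < 1"
    using assms abs_Re_le_cmod[of w] by (auto simp: x_def \<rho>_def cmod_power2)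
  have den: "(1 - x)\<^sup>2 + (Im w)\<^sup>2 > 0"
    using \<rho> by (intro add_pos_nonneg) auto
  have "0 \<le> (\<rho> + x) * (1 - \<rho>)" using \<rho> by simp
  then have "(1 - x)\<^sup>2 + (Im w)\<^sup>2 \<le> (1 - x) * (1 + \<rho>)"
    using \<rho>(1) by (simp add: power2_eq_square algebra_simps)
  then have "1 / (1 + \<rho>) \<le> (1 - x) / ((1 - x)\<^sup>2 + (Im w)\<^sup>2)"
    using den \<rho> by (simp add: divide_simps mult.commute)
  then show ?thesis
    by (simp add: Re_divide x_def \<rho>_def)
qed

text \<open>
  Equivalently, the Herglotz integral of the kernel \<open>(1 + \<zeta>) / (1 - \<zeta>) = 2 / (1 - \<zeta>) - 1\<close>, with
  \<open>\<zeta> = z * exp (\<i> * \<theta>)\<close>, has positive real part. The lower bound of the kernel is uniform in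
  \<open>\<theta>\<close>, which keeps the inequality strict after integration.
\<close>

lemma Re_cauchy_transform_gt:
  assumes mono: "mono_on {0..2*pi} \<mu>" and mass: "\<mu> (2*pi) - \<mu> 0 = 1" and z: "norm z < 1"
  shows "Re (cauchy_transform \<mu> z) > 1 / 2"
proof -
  have "1 / 2 < 1 / (1 + norm z)" using z by (simp add: divide_simps add_pos_nonneg)
  also have "1 / (1 + norm z) * (\<mu> (2*pi) - \<mu> 0) \<le> Re (cauchy_transform \<mu> z)"
    unfolding cauchy_transform_def
  proof (rule stieltjes_integral_Re_ge[OF _ mono continuous_cauchy_kernel[OF z]])
    show "1 / (1 + norm z) \<le> Re (1 / (1 - z * unit_exp \<theta>))" for \<theta>
      using Re_cauchy_kernel_ge[of "z * unit_exp \<theta>"] z by simp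
  qed simp
  finally show ?thesis using mass by simp
qed

section \<open>The Herglotz representation\<close>

lemma integral_exp_int:
  "((\<lambda>t. exp (\<i> * of_int j * of_real t)) has_integral (if j = 0 then 2 * of_real pi else 0)) {0..2*pi}"
proof (cases "j = 0")
  case True
  then show ?thesis using has_integral_const_real[of "1::complex" 0 "2*pi"]
    by (simp add: scaleR_conv_of_real)
next
  case False
  have "((\<lambda>t. exp (\<i> * of_int j * of_real t)) has_integral
      (exp (\<i> * of_int j * of_real (2*pi)) / (\<i> * of_int j) -
       exp (\<i> * of_int j * of_real 0) / (\<i> * of_int j)))
      {0..2*pi}"
  proof (rule fundamental_theorem_of_calculus)
    fix t :: real
    show "((\<lambda>t. exp (\<i> * of_int j * of_real t) / (\<i> * of_int j)) has_vector_derivative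
        exp (\<i> * of_int j * of_real t)) (at t within {0..2*pi})"
      using False by (auto intro!: derivative_eq_intros has_vector_derivative_real_field)
  qed simp
  moreover have "exp (\<i> * of_int j * of_real (2*pi)) = 1"
    using exp_2pi_1_int[of j] by (simp add: mult_ac)
  ultimately show ?thesis using False by simp
qed

text \<open>
  On the circle of radius \<open>r\<close>, traversed clockwise, twice the real part of \<open>P\<close> is the series of
  \<open>P\<close> plus its conjugate. The first contributes the frequencies \<open>- m \<le> 0\<close> and the second the frequencies
  \<open>m \<ge> 0\<close>, so by orthogonality multiplication by \<open>exp (\<i> * k * t)\<close> singles out \<open>p k\<close>, and for
  \<open>k = 0\<close> also the conjugate constant term.
\<close>

lemma Re_fourier_coefficient:
  fixes P :: "complex \<Rightarrow> complex"
  assumes P: "\<And>z. norm z < 1 \<Longrightarrow> (\<lambda>n. p n * z ^ n) sums P z" and r: "0 < r" "r < 1"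
  shows "integral {0..2*pi} (\<lambda>t. Re (P (of_real r * exp (- \<i> * of_real t))) *\<^sub>R unit_exp t ^ k) =
    of_real pi * (p k * of_real r ^ k + (if k = 0 then cnj (p 0) else 0))"
proof -
  let ?w = "\<lambda>t. of_real r * exp (- \<i> * of_real t)"
  define e :: "int \<Rightarrow> real \<Rightarrow> complex" where "e j t = exp (\<i> * of_int j * of_real t)" for j t
  define G where "G m t = p m * of_real r ^ m * e (int k - int m) t +
      cnj (p m) * of_real r ^ m * e (int k + int m) t" for m t
  have e_exp: "exp (- \<i> * of_real t) = e (- 1) t" "unit_exp t = e 1 t" for t
    by (simp_all add: e_def)
  have e_pow: "e j t ^ m = e (int m * j) t" for j m t
    by (simp add: e_def exp_of_nat_mult[symmetric] mult_ac)
  have e_add: "e i t * e j t = e (i + j) t" for i j t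
    by (simp add: e_def exp_add[symmetric] algebra_simps)
  have e_cnj: "cnj (e j t) = e (- j) t" for j t
    by (simp add: e_def exp_cnj)
  have norm_e: "norm (e j t) = 1" for j t
    by (simp add: e_def)
  have sums: "(\<lambda>m. G m t) sums
      ((P (?w t) + cnj (P (?w t))) * unit_exp t ^ k)" for t
    unfolding e_exp
  proof -
    let ?z = "of_real r * e (- 1) t"
    have z: "(\<lambda>m. p m * ?z ^ m) sums P ?z" using r by (intro P) (simp add: norm_mult norm_e)
    then have "(\<lambda>m. cnj (p m * ?z ^ m)) sums cnj (P ?z)" by (simp only: sums_cnj)
    from sums_mult2[OF sums_add[OF z this], of "e 1 t ^ k"]
    show "(\<lambda>m. G m t) sums ((P ?z + cnj (P ?z)) * e 1 t ^ k)"
      by (simp add: power_mult_distrib e_pow e_cnj G_def distrib_right mult.assoc e_add add.commute)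
  qed
  have int_e: "(e j has_integral (if j = 0 then 2 * of_real pi else 0)) {0..2*pi}" for j
    using integral_exp_int[of j] by (simp add: e_def[abs_def])
  have int_G: "(G m has_integral
      (p m * of_real r ^ m * (if int k - int m = 0 then 2 * of_real pi else 0) +
      cnj (p m) * of_real r ^ m * (if int k + int m = 0 then 2 * of_real pi else 0))) {0..2*pi}" for m
    unfolding G_def[abs_def] by (intro has_integral_add has_integral_mult_right int_e)
  have "(\<lambda>m. integral {0..2*pi} (G m)) sums
      integral {0..2*pi} (\<lambda>t. (P (?w t) + cnj (P (?w t))) * unit_exp t ^ k)"
  proof (rule integral_sums_dominated[OF _ _ _ sums])
    show "G m integrable_on {0..2*pi}" for m using int_G by blast
    show "norm (G m t) \<le> 2 * norm (p m * of_real r ^ m)" for m t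
      unfolding G_def by (rule order_trans[OF norm_triangle_ineq]) (simp add: norm_mult norm_e)
    have "summable (\<lambda>m. norm (p m * of_real r ^ m))"
    proof (rule powser_insidea)
      show "summable (\<lambda>m. p m * of_real ((1 + r) / 2) ^ m)"
        using P[of "of_real ((1 + r) / 2)"] r
          by (auto simp: sums_iff simp del: of_real_add of_real_divide)
      show "norm (of_real r :: complex) < norm (of_real ((1 + r) / 2) :: complex)"
        using r by (simp del: of_real_add of_real_divide)
    qed
    then show "summable (\<lambda>m. 2 * norm (p m * of_real r ^ m))" by (rule summable_mult)
  qed
  moreover have "(\<lambda>m. integral {0..2*pi} (G m)) sums
      (2 * of_real pi * p k * of_real r ^ k + (if k = 0 then 2 * of_real pi * cnj (p 0) else 0))"
  proof -
    have "(\<lambda>m. (if m = k then 2 * of_real pi * p m * of_real r ^ m else 0) +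
          (if m = 0 then if k = 0 then 2 * of_real pi * cnj (p m) else 0 else 0)) sums
        (2 * of_real pi * p k * of_real r ^ k + (if k = 0 then 2 * of_real pi * cnj (p 0) else 0))"
      by (intro sums_add sums_single)
    moreover have "integral {0..2*pi} (G m) =
          (if m = k then 2 * of_real pi * p m * of_real r ^ m else 0) +
          (if m = 0 then if k = 0 then 2 * of_real pi * cnj (p m) else 0 else 0)" for m
      using integral_unique[OF int_G[of m]] by (auto simp: algebra_simps)
    ultimately show ?thesis by presburger
  qed
  ultimately have "integral {0..2*pi} (\<lambda>t. (P (?w t) + cnj (P (?w t))) * unit_exp t ^ k) =
     2 * (of_real pi * (p k * of_real r ^ k + (if k = 0 then cnj (p 0) else 0)))"
    by (subst sums_unique2) (assumption | simp add: algebra_simps)+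
  moreover have "(P w + cnj (P w)) * u = 2 * (Re (P w) *\<^sub>R u)" for w u
    by (simp add: complex_add_cnj scaleR_conv_of_real)
  ultimately have "2 * integral {0..2*pi} (\<lambda>t. Re (P (?w t)) *\<^sub>R unit_exp t ^ k) =
     2 * (of_real pi * (p k * of_real r ^ k + (if k = 0 then cnj (p 0) else 0)))"
    by (simp only: integral_mult_right)
  then show ?thesis by (simp only: mult_cancel_left) simp
qed

text \<open>
  On each circle of radius \<open>r < 1\<close> the normalized real part of \<open>P\<close> is the density of a probability
  distribution, whose moments of order \<open>k > 0\<close> are the Taylor coefficients of \<open>P\<close> damped by \<open>r ^ k\<close>
  and divided by \<open>2 * Re (P 0)\<close>. Along \<open>r \<rightarrow> 1\<close> the selection theorem gives a distribution with undamped moments, and these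
  determine \<open>P\<close> through the Cauchy transform. The right-hand side is the classical integral of
  the kernel \<open>(1 + \<zeta>) / (1 - \<zeta>)\<close>, written with \<open>2 / (1 - \<zeta>) - 1\<close> instead.
\<close>

theorem herglotz_representation:
  fixes P :: "complex \<Rightarrow> complex"
  assumes hol: "P holomorphic_on ball 0 1" and pos: "\<And>z. norm z < 1 \<Longrightarrow> Re (P z) > 0"
  obtains \<mu> where "mono_on {0..2*pi} \<mu>" "\<mu> 0 = 0" "\<mu> (2*pi) = 1"
    "\<And>z. norm z < 1 \<Longrightarrow> P z = Re (P 0) * (2 * cauchy_transform \<mu> z - 1) + \<i> * Im (P 0)"
proof -
  define p where "p n = (deriv ^^ n) P 0 / fact n" for n
  have sums: "(\<lambda>n. p n * z ^ n) sums P z" if "norm z < 1" for z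
    using holomorphic_power_series[OF hol, of z] that by (simp add: p_def)
  have p0: "p 0 = P 0" by (simp add: p_def)
  define c where "c = Re (P 0)"
  have c: "c > 0" using pos[of 0] by (simp add: c_def)
  define r :: "nat \<Rightarrow> real" where "r n = 1 - 1 / real (n + 2)" for n
  have r: "0 < r n" "r n < 1" for n by (auto simp: r_def)
  have r_lim: "r \<longlonglongrightarrow> 1"
    unfolding r_def by real_asymp
  \<comment> \<open>The clockwise parametrization matches a kernel in \<open>exp (\<i> * \<theta>)\<close> instead of its conjugate.\<close>
  define h where "h n t = Re (P (of_real (r n) * exp (- \<i> * of_real t))) / (2 * pi * c)" for n t
  have in_disc: "of_real (r n) * exp (- \<i> * of_real t) \<in> ball 0 1" for n t
    using r[of n] by (simp add: norm_mult)
  have h_cont: "continuous_on UNIV (h n)" for n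
  proof -
    have "continuous_on UNIV (\<lambda>t. P (of_real (r n) * exp (- \<i> * of_real t)))"
      using in_disc
      by (intro continuous_on_compose2[OF holomorphic_on_imp_continuous_on[OF hol]] continuous_intros) auto
    then show ?thesis unfolding h_def using c by (intro continuous_intros) auto
  qed
  have h_nonneg: "h n t \<ge> 0" for n t
    using pos[of "of_real (r n) * exp (- \<i> * of_real t)"] in_disc[of n t] c
    by (simp add: h_def less_imp_le)
  have h_int: "h n integrable_on {u..v}" for n u v
    by (intro integrable_continuous_real continuous_on_subset[OF h_cont]) auto
  have h_moment: "integral {0..2*pi} (\<lambda>t. h n t *\<^sub>R unit_exp t ^ k) =
      (if k = 0 then 1 else p k * of_real (r n) ^ k / of_real (2 * c))" for n k
  proof -
    have "integral {0..2*pi} (\<lambda>t. h n t *\<^sub>R unit_exp t ^ k) =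
        integral {0..2*pi} (\<lambda>t. (1 / (2 * pi * c)) *\<^sub>R
          (Re (P (of_real (r n) * exp (- \<i> * of_real t))) *\<^sub>R unit_exp t ^ k))"
      by (intro integral_cong) (simp add: h_def)
    also have "\<dots> = (1 / (2 * pi * c)) *\<^sub>R
        (of_real pi * (p k * of_real (r n) ^ k + (if k = 0 then cnj (p 0) else 0)))"
      by (subst integral_cmul) (simp only: Re_fourier_coefficient[OF sums r])
    also have "\<dots> = (if k = 0 then 1 else p k * of_real (r n) ^ k / of_real (2 * c))"
      using c by (auto simp: scaleR_conv_of_real p0 complex_add_cnj c_def)
    finally show ?thesis .
  qed
  define M where "M n x = (if x \<in> {0..2*pi} then integral {0..x} (h n) else 0)" for n x
  have M_eq: "M n x = integral {0..x} (h n)" if "x \<in> {0..2*pi}" for n x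
    using that by (simp add: M_def)
  have M_mono: "mono_on {0..2*pi} (M n)" for n
    by (rule mono_onI) (auto simp: M_eq intro!: integral_subset_le h_int h_nonneg)
  have M_0: "M n 0 = 0" for n by (simp add: M_eq)
  have M_2pi: "M n (2*pi) = 1" for n
  proof -
    have "complex_of_real (integral {0..2*pi} (h n)) = integral {0..2*pi} (\<lambda>t. complex_of_real (h n t))"
      by (subst integral_linear[OF h_int bounded_linear_of_real, unfolded o_def]) (rule refl)
    also have "\<dots> = 1" using h_moment[of n 0] by (simp add: scaleR_conv_of_real)
    finally show ?thesis by (simp add: M_eq)
  qed
  have M_range: "M n x \<in> {0..1}" for n x
  proof (cases "x \<in> {0..2*pi}")
    case True
    then have "M n 0 \<le> M n x" "M n x \<le> M n (2*pi)"
      by (auto intro!: mono_onD[OF M_mono])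
    then show ?thesis by (simp add: M_0 M_2pi)
  qed (auto simp: M_def)
  obtain \<mu> where \<mu>: "mono_on {0..2*pi} \<mu>" "\<mu> 0 = 0" "\<mu> (2*pi) = 1"
    and \<mu>_lim: "\<And>g l. continuous_on UNIV g \<Longrightarrow> (\<lambda>n. stieltjes_integral g (M n) 0 (2*pi)) \<longlonglongrightarrow> l \<Longrightarrow>
       stieltjes_integral g \<mu> 0 (2*pi) = l"
    using helly_cluster_point[of 0 "2*pi" M, OF _ M_mono M_0 M_2pi M_range] by auto
  have moment_0: "moment \<mu> 0 = 1"
    using stieltjes_integral_const[OF _ \<mu>(1), of 1] \<mu> by (simp add: moment_def)
  have moment_eq: "moment \<mu> k = p k / of_real (2 * c)" if "k \<noteq> 0" for k
    unfolding moment_def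
  proof (rule \<mu>_lim)
    have "stieltjes_integral (\<lambda>\<theta>. unit_exp \<theta> ^ k) (M n) 0 (2*pi) =
        p k * of_real (r n) ^ k / of_real (2 * c)" for n
      using stieltjes_integral_density[OF _ _ h_cont[of n] h_nonneg M_eq[where n = n],
          where g = "\<lambda>\<theta>. unit_exp \<theta> ^ k"]
        h_moment[of n k] that
      by (simp add: continuous_intros)
    moreover have "(\<lambda>n. p k * of_real (r n) ^ k / of_real (2 * c))
        \<longlonglongrightarrow> p k * of_real 1 ^ k / of_real (2 * c)"
      using c by (intro tendsto_intros r_lim) simp
    ultimately show "(\<lambda>n. stieltjes_integral (\<lambda>\<theta>. unit_exp \<theta> ^ k) (M n) 0 (2*pi))
        \<longlonglongrightarrow> p k / of_real (2 * c)"
      by simp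
  qed (intro continuous_intros)
  show ?thesis
  proof (rule that[OF \<mu>])
    fix z :: complex assume z: "norm z < 1"
    have "(\<lambda>k. of_real (2 * c) * (moment \<mu> k * z ^ k) +
          (if k = 0 then P 0 - of_real (2 * c) else 0)) sums
        (of_real (2 * c) * cauchy_transform \<mu> z + (P 0 - of_real (2 * c)))"
      by (intro sums_add sums_mult cauchy_transform_sums[OF \<mu>(1) z] sums_single)
    moreover have coeff: "of_real (2 * c) * (moment \<mu> k * z ^ k) +
          (if k = 0 then P 0 - of_real (2 * c) else 0) = p k * z ^ k" for k
      using c by (cases "k = 0") (simp_all add: moment_0 moment_eq p0)
    ultimately have "(\<lambda>k. p k * z ^ k) sums
        (of_real (2 * c) * cauchy_transform \<mu> z + (P 0 - of_real (2 * c)))"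
      by (simp only: coeff)
    then have "P z = of_real (2 * c) * cauchy_transform \<mu> z + (P 0 - of_real (2 * c))"
      using sums[OF z] sums_unique2 by blast
    also have "P 0 = of_real c + \<i> * Im (P 0)"
      by (simp add: c_def complex_eq[symmetric])
    finally show "P z = Re (P 0) * (2 * cauchy_transform \<mu> z - 1) + \<i> * Im (P 0)"
      by (simp add: c_def algebra_simps)
  qed
qed

section \<open>Integrating the Herglotz representation\<close>

lemma has_field_derivative_representation:
  assumes "mono_on {0..2*pi} \<mu>" "norm z < 1"
  shows "((\<lambda>z. - of_real c * ((1 + \<i> * of_real c1) * z + 2 * log_transform \<mu> z))
     has_field_derivative of_real c * (2 * cauchy_transform \<mu> z - 1) - \<i> * of_real (c * c1)) (at z)"
  by (rule derivative_eq_intros has_field_derivative_log_transform assms refl)+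
     (simp add: algebra_simps)

theorem theorem2:
  fixes f \<phi> :: "complex \<Rightarrow> complex"
  assumes "f analytic_on ball 0 1"
    and "inj_on f (ball 0 1)"
    and "\<phi> analytic_on f ` ball 0 1"
  shows "(\<forall>z\<in>ball 0 1.
            Re (deriv (\<lambda>z. \<phi> (f z)) z) = Re (deriv \<phi> (f z) * deriv f z) \<and>
            Re (deriv \<phi> (f z) * deriv f z) > 0)
     \<longleftrightarrow>
     (\<exists>(c::real) (c\<^sub>1::real) (c\<^sub>0::complex) (\<mu>::real \<Rightarrow> real).
        c > 0 \<and> mono_on {0..2*pi} \<mu> \<and> total_variation \<mu> 0 (2*pi) = 1 \<and>
        (\<forall>w\<in>f ` ball 0 1.
           \<phi> w = - of_real c *
             ((1 + \<i> * of_real c\<^sub>1) * inv_into (ball 0 1) f w +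
              2 * stieltjes_integral
                    (\<lambda>\<theta>. exp (- \<i> * of_real \<theta>) *
                         Ln (1 - inv_into (ball 0 1) f w * exp (\<i> * of_real \<theta>)))
                    \<mu> 0 (2*pi))
             + c\<^sub>0))" (is "?L \<longleftrightarrow> ?R")
proof -
  let ?g = "\<lambda>z. \<phi> (f z)"
  have g: "?g analytic_on ball 0 1"
    using analytic_on_compose[OF assms(1,3)] by (simp add: o_def)
  have chain: "deriv ?g z = deriv \<phi> (f z) * deriv f z" if "z \<in> ball 0 1" for z
    using deriv_chain[of f z \<phi>] assms(1,3) that
    by (simp add: o_def analytic_on_imp_differentiable_at)
  have L: "?L \<longleftrightarrow> (\<forall>z\<in>ball 0 1. Re (deriv ?g z) > 0)"
    using chain by auto
  have inv: "inv_into (ball 0 1) f (f z) = z" if "z \<in> ball 0 1" for z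
    by (rule inv_into_f_f[OF assms(2) that])
  have rep_iff: "(\<forall>w\<in>f ` ball 0 1. \<phi> w = - of_real c *
             ((1 + \<i> * of_real c1) * inv_into (ball 0 1) f w +
              2 * stieltjes_integral
                    (\<lambda>\<theta>. exp (- \<i> * of_real \<theta>) *
                         Ln (1 - inv_into (ball 0 1) f w * exp (\<i> * of_real \<theta>)))
                    \<mu> 0 (2*pi)) + c0) \<longleftrightarrow>
      (\<forall>z\<in>ball 0 1. ?g z = - of_real c * ((1 + \<i> * of_real c1) * z + 2 * log_transform \<mu> z) + c0)"
    for c c1 c0 \<mu>
    unfolding log_transform_def ball_simps(9) by (rule ball_cong[OF refl]) (simp only: inv)
  have variation_iff: "total_variation \<mu> 0 (2*pi) = 1 \<longleftrightarrow> \<mu> (2*pi) - \<mu> 0 = 1"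
    if "mono_on {0..2*pi} \<mu>" for \<mu>
    using total_variation_mono_on[OF _ that] by simp
  have R: "?R \<longleftrightarrow> (\<exists>c c1 c0 \<mu>. c > 0 \<and> mono_on {0..2*pi} \<mu> \<and> \<mu> (2*pi) - \<mu> 0 = 1 \<and>
        (\<forall>z\<in>ball 0 1. ?g z = - of_real c * ((1 + \<i> * of_real c1) * z + 2 * log_transform \<mu> z) + c0))"
    unfolding rep_iff using variation_iff by blast
  have der: "(?g has_field_derivative deriv ?g z) (at z)" if "z \<in> ball 0 1" for z
    using g that analytic_on_imp_differentiable_at DERIV_deriv_iff_field_differentiable by blast
  show ?thesis
    unfolding L R
  proof
    assume pos: "\<forall>z\<in>ball 0 1. Re (deriv ?g z) > 0"
    have hol: "deriv ?g holomorphic_on ball 0 1"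
      using g by (intro holomorphic_deriv analytic_imp_holomorphic) auto
    have pos': "Re (deriv ?g z) > 0" if "norm z < 1" for z
      using pos that by simp
    obtain \<mu> where \<mu>: "mono_on {0..2*pi} \<mu>" "\<mu> 0 = 0" "\<mu> (2*pi) = 1"
      "\<And>z. norm z < 1 \<Longrightarrow> deriv ?g z =
         Re (deriv ?g 0) * (2 * cauchy_transform \<mu> z - 1) + \<i> * Im (deriv ?g 0)"
      using herglotz_representation[OF hol pos'] by blast
    define c c1 where "c = Re (deriv ?g 0)" and "c1 = - Im (deriv ?g 0) / c"
    have c: "c > 0" using pos by (simp add: c_def)
    let ?q = "\<lambda>z. - of_real c * ((1 + \<i> * of_real c1) * z + 2 * log_transform \<mu> z)"
    have "((\<lambda>z. ?g z - ?q z) has_field_derivative 0) (at z within ball 0 1)"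
      if z: "z \<in> ball 0 1" for z
    proof -
      have "of_real c * (2 * cauchy_transform \<mu> z - 1) - \<i> * of_real (c * c1) = deriv ?g z"
        using z c \<mu>(4)[of z] by (simp add: c1_def c_def)
      then have "(?q has_field_derivative deriv ?g z) (at z)"
        using has_field_derivative_representation[OF \<mu>(1), of z c c1] z by simp
      from DERIV_diff[OF der[OF z] this] show ?thesis
        by (simp add: has_field_derivative_at_within)
    qed
    from has_field_derivative_zero_constant[OF convex_ball this]
    obtain c0 where c0: "\<forall>z\<in>ball 0 1. ?g z - ?q z = c0" by blast
    have "\<forall>z\<in>ball 0 1. ?g z = - of_real c * ((1 + \<i> * of_real c1) * z + 2 * log_transform \<mu> z) + c0"
    proof
      fix z :: complex assume "z \<in> ball 0 1"
      with c0 have "?g z - ?q z = c0" by blast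
      then have "?g z = c0 + ?q z" by (simp only: diff_eq_eq)
      then show "?g z = - of_real c * ((1 + \<i> * of_real c1) * z + 2 * log_transform \<mu> z) + c0"
        by (simp only: add.commute)
    qed
    moreover have "\<mu> (2*pi) - \<mu> 0 = 1" using \<mu>(2,3) by simp
    ultimately show "\<exists>c c1 c0 \<mu>. c > 0 \<and> mono_on {0..2*pi} \<mu> \<and> \<mu> (2*pi) - \<mu> 0 = 1 \<and>
        (\<forall>z\<in>ball 0 1. ?g z = - of_real c * ((1 + \<i> * of_real c1) * z + 2 * log_transform \<mu> z) + c0)"
      using c \<mu>(1) by blast
  next
    assume "\<exists>c c1 c0 \<mu>. c > 0 \<and> mono_on {0..2*pi} \<mu> \<and> \<mu> (2*pi) - \<mu> 0 = 1 \<and>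
        (\<forall>z\<in>ball 0 1. ?g z = - of_real c * ((1 + \<i> * of_real c1) * z + 2 * log_transform \<mu> z) + c0)"
    then obtain c c1 c0 \<mu> where c: "c > (0::real)" and \<mu>: "mono_on {0..2*pi} \<mu>" "\<mu> (2*pi) - \<mu> 0 = 1"
      and rep: "\<And>z. z \<in> ball 0 1 \<Longrightarrow> ?g z =
          - of_real c * ((1 + \<i> * of_real c1) * z + 2 * log_transform \<mu> z) + c0"
      by blast
    show "\<forall>z\<in>ball 0 1. Re (deriv ?g z) > 0"
    proof
      fix z :: complex assume z: "z \<in> ball 0 1"
      then have z': "norm z < 1" by simp
      have "((\<lambda>z. - of_real c * ((1 + \<i> * of_real c1) * z + 2 * log_transform \<mu> z) + c0)
          has_field_derivative
          of_real c * (2 * cauchy_transform \<mu> z - 1) - \<i> * of_real (c * c1) + 0) (at z)"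
        by (intro DERIV_add has_field_derivative_representation[OF \<mu>(1) z'] DERIV_const)
      then have "(?g has_field_derivative
          of_real c * (2 * cauchy_transform \<mu> z - 1) - \<i> * of_real (c * c1)) (at z)"
        unfolding add_0_right
        by (rule has_field_derivative_transform_within_open[OF _ open_ball z]) (simp only: rep)
      then have "deriv ?g z = of_real c * (2 * cauchy_transform \<mu> z - 1) - \<i> * of_real (c * c1)"
        by (rule DERIV_imp_deriv)
      then show "Re (deriv ?g z) > 0"
        using c Re_cauchy_transform_gt[OF \<mu> z'] by simp
    qed
  qed
qed

end
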